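(* Let $(T_i)_{i=1}^{\infty}$ be a sequence of bounded linear operators from a normed linear space $X$ to a normed linear space $Y$. Then the following assertions are equivalent: (1) $(T_i)_{i}$ is mean Li-Yorke extremely chaotic; (2) there exists a mean Li-Yorke extreme pair for $(T_i)_i$; (3) there exists an absolutely mean irregular vector for $(T_i)_i$.
   Context: Normed spaces are over $\mathbb{K}=\mathbb{R}$ or $\mathbb{C}$. For a sequence $(T_i)_{i=1}^\infty$ of bounded linear operators from a normed linear space $X$ to a normed linear space $Y$: a pair $(x,y)\in X\times X$ is a \emph{mean Li-Yorke extreme pair} if $\liminf_{n\to\infty}\frac1n\sum_{i=1}^n\Vert T_ix-T_iy\Vert=0$ and $\limsup_{n\to\infty}\frac1n\sum_{i=1}^n\Vert T_ix-T_iy\Vert=\infty$. A subset $K\subset X$ is \emph{mean Li-Yorke extremely scrambled} if any two distinct points of $K$ form a mean Li-Yorke extreme pair. $(T_i)_i$ is \emph{mean Li-Yorke extremely chaotic} if there exists an uncountable mean Li-Yorke extremely scrambled subset of $X$. A vector $x\in X$ is \emph{absolutely mean irregular} if $\liminf_{n\to\infty}\frac1n\sum_{i=1}^n\Vert T_ix\Vert=0$ and $\limsup_{n\to\infty}\frac1n\sum_{i=1}^n\Vert T_ix\Vert=\infty$. *)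

theory Defs
  imports "HOL-Analysis.Analysis"
begin

(* A normed space over K = R or C.  The scalar field is a type of class real_normed_field: real and
   complex are instances, and up to isometric isomorphism they are the only ones (Gelfand-Mazur),
   so quantifying over this class is quantifying over K.  The class real_normed_vector supplies
   the addition, the norm and the underlying real scalar multiplication of the space; for K = C the
   latter is the restriction of the complex one. *)

locale normed_space_over = vector_space scale
  for scale :: "'k::real_normed_field \<Rightarrow> 'a::real_normed_vector \<Rightarrow> 'a" +
  assumes norm_scale: "norm (scale c x) = norm c * norm x"
    and scale_of_real: "scale (of_real r) x = r *\<^sub>R x"

locale bounded_linear_over =
  dom: normed_space_over scaleX + cod: normed_space_over scaleY +
  Vector_Spaces.linear scaleX scaleY f
  for scaleX :: "'k::real_normed_field \<Rightarrow> 'a::real_normed_vector \<Rightarrow> 'a"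
    and scaleY :: "'k \<Rightarrow> 'b::real_normed_vector \<Rightarrow> 'b"
    and f :: "'a \<Rightarrow> 'b" +
  assumes bounded: "\<exists>B. \<forall>x. norm (f x) \<le> norm x * B"

lemma normed_space_over_real:
  "normed_space_over (scaleR :: real \<Rightarrow> 'a::real_normed_vector \<Rightarrow> 'a)"
  by unfold_locales (auto simp: algebra_simps)

lemma normed_space_over_complex:
  "normed_space_over ((*) :: complex \<Rightarrow> complex \<Rightarrow> complex)"
  by unfold_locales (auto simp: algebra_simps norm_mult scaleR_conv_of_real)

lemma bounded_linear_over_imp_bounded_linear:
  assumes "bounded_linear_over scaleX scaleY f"
  shows "bounded_linear f"
proof -
  interpret bounded_linear_over scaleX scaleY f by fact
  show ?thesis
  proof
    show "f (x + y) = f x + f y" for x y by (rule add)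
    show "f (r *\<^sub>R x) = r *\<^sub>R f x" for r x
      using scale[of "of_real r" x] by (simp add: dom.scale_of_real cod.scale_of_real)
    show "\<exists>K. \<forall>x. norm (f x) \<le> norm x * K" by (rule bounded)
  qed
qed

lemma bounded_linear_over_real_iff:
  "bounded_linear_over scaleR scaleR f \<longleftrightarrow> bounded_linear f"
proof
  assume "bounded_linear f"
  then interpret bounded_linear f .
  show "bounded_linear_over scaleR scaleR f"
    by (intro bounded_linear_over.intro normed_space_over_real bounded_linear_over_axioms.intro
        bounded linear_axioms[unfolded linear_def])
qed (rule bounded_linear_over_imp_bounded_linear)

(* Operator sequences are indexed from 1: the value at index 0 is never used.  The limits are taken
   in the extended reals, and the junk value of the mean at n = 0 does not affect them. *)

definition mean_Li_Yorke_extreme_pair ::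
    "(nat \<Rightarrow> 'a \<Rightarrow> 'b::real_normed_vector) \<Rightarrow> 'a \<Rightarrow> 'a \<Rightarrow> bool" where
  "mean_Li_Yorke_extreme_pair T x y \<longleftrightarrow>
     liminf (\<lambda>n. ereal (1 / real n * (\<Sum>i=1..n. norm (T i x - T i y)))) = 0 \<and>
     limsup (\<lambda>n. ereal (1 / real n * (\<Sum>i=1..n. norm (T i x - T i y)))) = \<infinity>"

definition mean_Li_Yorke_extremely_scrambled ::
    "(nat \<Rightarrow> 'a \<Rightarrow> 'b::real_normed_vector) \<Rightarrow> 'a set \<Rightarrow> bool" where
  "mean_Li_Yorke_extremely_scrambled T K \<longleftrightarrow>
     (\<forall>x\<in>K. \<forall>y\<in>K. x \<noteq> y \<longrightarrow> mean_Li_Yorke_extreme_pair T x y)"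

definition mean_Li_Yorke_extremely_chaotic ::
    "(nat \<Rightarrow> 'a \<Rightarrow> 'b::real_normed_vector) \<Rightarrow> bool" where
  "mean_Li_Yorke_extremely_chaotic T \<longleftrightarrow>
     (\<exists>K. uncountable K \<and> mean_Li_Yorke_extremely_scrambled T K)"

definition absolutely_mean_irregular ::
    "(nat \<Rightarrow> 'a \<Rightarrow> 'b::real_normed_vector) \<Rightarrow> 'a \<Rightarrow> bool" where
  "absolutely_mean_irregular T x \<longleftrightarrow>
     liminf (\<lambda>n. ereal (1 / real n * (\<Sum>i=1..n. norm (T i x)))) = 0 \<and>
     limsup (\<lambda>n. ereal (1 / real n * (\<Sum>i=1..n. norm (T i x)))) = \<infinity>"

end

theory Submission
  imports Defs
begin

text \<open>By linearity, \<open>(x, y)\<close> is an extreme pair iff \<open>x - y\<close> is absolutely mean irregular, and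
irregularity is invariant under nonzero scaling; hence the real line through an irregular vector
is an uncountable scrambled set.\<close>

text \<open>Linearity is asked only for \<open>i \<ge> 1\<close>: the means start at index 1, so
  \<open>T 0\<close> may be arbitrary.\<close>

lemma extreme_pair_iff_irregular_diff:
  assumes "\<And>i. i \<ge> 1 \<Longrightarrow> linear (T i)"
  shows "mean_Li_Yorke_extreme_pair T x y \<longleftrightarrow> absolutely_mean_irregular T (x - y)"
proof -
  have "(\<Sum>i=1..n. norm (T i x - T i y)) = (\<Sum>i=1..n. norm (T i (x - y)))" for n
    by (intro sum.cong) (auto simp: linear_diff assms)
  then show ?thesis
    by (simp add: mean_Li_Yorke_extreme_pair_def absolutely_mean_irregular_def)
qed

lemma absolutely_mean_irregular_scaleR:
  assumes "\<And>i. i \<ge> 1 \<Longrightarrow> linear (T i)"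
    and "c \<noteq> 0" and "absolutely_mean_irregular T x"
  shows "absolutely_mean_irregular T (c *\<^sub>R x)"
proof -
  have "(\<Sum>i=1..n. norm (T i (c *\<^sub>R x))) = \<bar>c\<bar> * (\<Sum>i=1..n. norm (T i x))" for n
    by (auto simp: linear_scale assms sum_distrib_left intro!: sum.cong)
  then have "ereal (1 / real n * (\<Sum>i=1..n. norm (T i (c *\<^sub>R x)))) =
      ereal \<bar>c\<bar> * ereal (1 / real n * (\<Sum>i=1..n. norm (T i x)))" for n
    by simp
  \<comment> \<open>The finite factor \<open>\<bar>c\<bar>\<close> comes out of both limits before
    the product merges back into a single \<open>ereal\<close>. Since \<open>c \<noteq> 0\<close>,
    it then preserves the values 0 and \<open>\<infinity>\<close>; for \<open>c = 0\<close> the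
    limsup would collapse, as 0 times \<open>\<infinity>\<close> is 0.\<close>
  then show ?thesis
    using assms(2,3) unfolding absolutely_mean_irregular_def
    by (simp only: Limsup_ereal_mult_left Liminf_ereal_mult_left sequentially_bot abs_ge_zero not_False_eq_True) simp
qed

text \<open>At the zero vector all means vanish, so their limsup is 0 and not
  \<open>\<infinity>\<close>. This makes \<open>r \<mapsto> r x\<close> injective below.\<close>

lemma absolutely_mean_irregular_nonzero:
  assumes "\<And>i. i \<ge> 1 \<Longrightarrow> linear (T i)" and "absolutely_mean_irregular T x"
  shows "x \<noteq> 0"
proof
  assume "x = 0"
  then have "(\<Sum>i=1..n. norm (T i x)) = 0" for n
    by (intro sum.neutral) (auto simp: linear_0 assms)
  then show False
    using assms(2) by (simp add: absolutely_mean_irregular_def Limsup_const zero_ereal_def)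
qed

lemma absolutely_mean_irregular_imp_chaotic:
  assumes lin: "\<And>i. i \<ge> 1 \<Longrightarrow> linear (T i)" and irr: "absolutely_mean_irregular T x"
  shows "mean_Li_Yorke_extremely_chaotic T"
  unfolding mean_Li_Yorke_extremely_chaotic_def
proof (intro exI conjI)
  have "x \<noteq> 0"
    using absolutely_mean_irregular_nonzero[of T x] lin irr by blast
  then have "inj (\<lambda>r::real. r *\<^sub>R x)"
    by (simp add: inj_on_def)
  then show "uncountable (range (\<lambda>r::real. r *\<^sub>R x))"
    using countable_image_inj_on uncountable_UNIV_real by blast
  \<comment> \<open>The difference of two points on the line is the nonzero multiple
    \<open>r - s\<close> of \<open>x\<close>.\<close>
  have "absolutely_mean_irregular T (r *\<^sub>R x - s *\<^sub>R x)" if "r \<noteq> s" for r s :: real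
    using absolutely_mean_irregular_scaleR[of T "r - s" x] lin irr that
    by (simp add: scaleR_left_diff_distrib)
  then show "mean_Li_Yorke_extremely_scrambled T (range (\<lambda>r::real. r *\<^sub>R x))"
    unfolding mean_Li_Yorke_extremely_scrambled_def
    by (auto simp: extreme_pair_iff_irregular_diff lin)
qed

lemma chaotic_imp_extreme_pair:
  assumes "mean_Li_Yorke_extremely_chaotic T"
  shows "\<exists>x y. mean_Li_Yorke_extreme_pair T x y"
proof -
  obtain K where "uncountable K" and scr: "mean_Li_Yorke_extremely_scrambled T K"
    using assms unfolding mean_Li_Yorke_extremely_chaotic_def by blast
  then have "infinite K"
    using countable_finite by blast
  then obtain x where "x \<in> K"
    using infinite_imp_nonempty by blast
  \<comment> \<open>\<open>K\<close> stays infinite after removing \<open>x\<close>, which yields a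
    second, distinct point.\<close>
  moreover obtain y where "y \<in> K - {x}"
    using infinite_imp_nonempty[OF infinite_remove[OF \<open>infinite K\<close>]] by blast
  ultimately show ?thesis
    using scr unfolding mean_Li_Yorke_extremely_scrambled_def by blast
qed

theorem proposition3p7:
  fixes scaleX :: "'k::real_normed_field \<Rightarrow> 'a::real_normed_vector \<Rightarrow> 'a"
    and scaleY :: "'k \<Rightarrow> 'b::real_normed_vector \<Rightarrow> 'b"
    and T :: "nat \<Rightarrow> 'a \<Rightarrow> 'b"
  assumes "normed_space_over scaleX"
    and "normed_space_over scaleY"
    and "\<And>i. i \<ge> 1 \<Longrightarrow> bounded_linear_over scaleX scaleY (T i)"
  shows "(mean_Li_Yorke_extremely_chaotic T \<longleftrightarrow> (\<exists>x y. mean_Li_Yorke_extreme_pair T x y)) \<and>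
         ((\<exists>x y. mean_Li_Yorke_extreme_pair T x y) \<longleftrightarrow> (\<exists>x. absolutely_mean_irregular T x))"
proof -
  \<comment> \<open>Linearity over the scalar field restricts to the real scalars, the only ones
    used from here on.\<close>
  have lin: "linear (T i)" if "i \<ge> 1" for i
    using assms(3)[OF that] bounded_linear_over_imp_bounded_linear bounded_linear.linear by blast
  have "(\<exists>x. absolutely_mean_irregular T x)" if "\<exists>x y. mean_Li_Yorke_extreme_pair T x y"
    using that by (auto simp: extreme_pair_iff_irregular_diff lin)
  moreover have "mean_Li_Yorke_extremely_chaotic T" if "\<exists>x. absolutely_mean_irregular T x"
    using that lin by (auto intro: absolutely_mean_irregular_imp_chaotic)
  \<comment> \<open>The cycle closes: chaos gives a pair, a pair gives the irregular vector
    \<open>x - y\<close>, and that vector gives chaos.\<close>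
  ultimately show ?thesis
    using chaotic_imp_extreme_pair[of T] by blast
qed

end
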